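(* Let $G$ be a finitely generated group and $X\subset A^G$ a subshift. For $n\in\mathbb N$ let $\mathcal C_n$ be the family of all subsets of $G$ of cardinality $n$. Then $X$ is uniformly SFT on $\mathcal C_n$ for every $n$ (not necessarily uniformly in $n$) if and only if $X$ is topologically $k$-mixing for all $k$.
   Context: $G$ carries a finite generating set and the left-invariant word metric $d$. $A$ is a finite alphabet, $G$ acts on $A^G$ by $(gx)_h=x_{g^{-1}h}$; a subshift is a closed $G$-invariant $X\subset A^G$. $X|C=\{x|C:x\in X\}$. A pattern is $P\in A^D$ with $D\subset G$ finite (possibly empty); it occurs in $y\in A^S$ if for some $g\in G$, $gD\subset S$ and $y_{gh}=P_h$ for all $h\in D$. $X$ is uniformly SFT on a family $\mathcal C$ of subsets of $G$ if there is a finite set $\mathcal P$ of patterns such that for all $C\in\mathcal C$ and $x\in A^C$: $x\in X|C$ iff no $P\in\mathcal P$ occurs in $x$. $X$ is topologically $k$-mixing if for any nonempty open $U_1,\dots,U_k\subset X$ there is $n$ such that for any $(g_1,\dots,g_k)\in G^k$ with $d(g_i,g_j)>n$ for all $i\ne j$, there is $x\in X$ with $g_i^{-1}x\in U_i$ for all $i$. *)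

theory Defs
  imports "HOL-Algebra.Coset" "HOL-Algebra.Generated_Groups" "HOL-Analysis.Product_Topology"
begin

text \<open>For a subset \<open>C\<close> of the group, \<open>A\<^sup>C\<close> is rendered as the extensional function
  space \<open>C \<rightarrow>\<^sub>E A\<close>, so that its elements are genuinely functions on \<open>C\<close>
  and \<open>restrict x C\<close> is the restriction of \<open>x\<close> to \<open>C\<close>.\<close>

definition word_length :: "('g, 'm) monoid_scheme \<Rightarrow> 'g set \<Rightarrow> 'g \<Rightarrow> nat" where
  "word_length G S g =
     (LEAST n. \<exists>ws. length ws = n \<and> set ws \<subseteq> S \<union> m_inv G ` S \<and>
                   foldr (\<lambda>a b. a \<otimes>\<^bsub>G\<^esub> b) ws \<one>\<^bsub>G\<^esub> = g)"

definition word_dist :: "('g, 'm) monoid_scheme \<Rightarrow> 'g set \<Rightarrow> 'g \<Rightarrow> 'g \<Rightarrow> nat" where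
  "word_dist G S g h = word_length G S (inv\<^bsub>G\<^esub> g \<otimes>\<^bsub>G\<^esub> h)"

definition config_topology :: "('g, 'm) monoid_scheme \<Rightarrow> 'a set \<Rightarrow> ('g \<Rightarrow> 'a) topology" where
  "config_topology G A = product_topology (\<lambda>_. discrete_topology A) (carrier G)"

definition shift :: "('g, 'm) monoid_scheme \<Rightarrow> 'g \<Rightarrow> ('g \<Rightarrow> 'a) \<Rightarrow> ('g \<Rightarrow> 'a)" where
  "shift G g x = (\<lambda>h\<in>carrier G. x (inv\<^bsub>G\<^esub> g \<otimes>\<^bsub>G\<^esub> h))"

definition subshift :: "('g, 'm) monoid_scheme \<Rightarrow> 'a set \<Rightarrow> ('g \<Rightarrow> 'a) set \<Rightarrow> bool" where
  "subshift G A X \<longleftrightarrow>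
     closedin (config_topology G A) X \<and> (\<forall>g\<in>carrier G. \<forall>x\<in>X. shift G g x \<in> X)"

definition restrictions :: "('g \<Rightarrow> 'a) set \<Rightarrow> 'g set \<Rightarrow> ('g \<Rightarrow> 'a) set" where
  "restrictions X C = (\<lambda>x. restrict x C) ` X"

text \<open>A pattern carries its domain explicitly: the domain of an extensional function cannot
  be recovered from the function when \<open>undefined \<in> A\<close>.\<close>

definition patterns :: "('g, 'm) monoid_scheme \<Rightarrow> 'a set \<Rightarrow> ('g set \<times> ('g \<Rightarrow> 'a)) set" where
  "patterns G A = {(D, P). D \<subseteq> carrier G \<and> finite D \<and> P \<in> D \<rightarrow>\<^sub>E A}"

text \<open>\<open>C\<close> is the domain of \<open>y\<close>.  A pattern with empty domain occurs in
  every \<open>y\<close>, including the one with \<open>C = {}\<close>.\<close>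

definition occurs_in ::
  "('g, 'm) monoid_scheme \<Rightarrow> 'g set \<times> ('g \<Rightarrow> 'a) \<Rightarrow> 'g set \<Rightarrow> ('g \<Rightarrow> 'a) \<Rightarrow> bool" where
  "occurs_in G p C y \<longleftrightarrow>
     (case p of (D, P) \<Rightarrow>
        \<exists>g\<in>carrier G. g <#\<^bsub>G\<^esub> D \<subseteq> C \<and> (\<forall>h\<in>D. y (g \<otimes>\<^bsub>G\<^esub> h) = P h))"

definition uniformly_SFT_on ::
  "('g, 'm) monoid_scheme \<Rightarrow> 'a set \<Rightarrow> ('g \<Rightarrow> 'a) set \<Rightarrow> 'g set set \<Rightarrow> bool" where
  "uniformly_SFT_on G A X \<C> \<longleftrightarrow>
     (\<exists>\<P>. finite \<P> \<and> \<P> \<subseteq> patterns G A \<and>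
        (\<forall>C\<in>\<C>. \<forall>x\<in>C \<rightarrow>\<^sub>E A. x \<in> restrictions X C \<longleftrightarrow> \<not> (\<exists>p\<in>\<P>. occurs_in G p C x)))"

definition subsets_of_card :: "('g, 'm) monoid_scheme \<Rightarrow> nat \<Rightarrow> 'g set set" where
  "subsets_of_card G n = {C. C \<subseteq> carrier G \<and> finite C \<and> card C = n}"

text \<open>The open sets are those of the subspace topology of \<open>X\<close>; \<open>S\<close> is the
  generating set of the word metric.  The \<open>k\<close>-tuples are indexed by \<open>{1..k}\<close>.\<close>

definition topologically_mixing ::
  "('g, 'm) monoid_scheme \<Rightarrow> 'g set \<Rightarrow> 'a set \<Rightarrow> ('g \<Rightarrow> 'a) set \<Rightarrow> nat \<Rightarrow> bool" where
  "topologically_mixing G S A X k \<longleftrightarrow>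
     (\<forall>U :: nat \<Rightarrow> ('g \<Rightarrow> 'a) set.
        (\<forall>i\<in>{1..k}. openin (subtopology (config_topology G A) X) (U i) \<and> U i \<noteq> {}) \<longrightarrow>
        (\<exists>n. \<forall>g. (\<forall>i\<in>{1..k}. g i \<in> carrier G) \<and>
                 (\<forall>i\<in>{1..k}. \<forall>j\<in>{1..k}. i \<noteq> j \<longrightarrow> word_dist G S (g i) (g j) > n) \<longrightarrow>
           (\<exists>x\<in>X. \<forall>i\<in>{1..k}. shift G (inv\<^bsub>G\<^esub> (g i)) x \<in> U i)))"

end

theory Submission imports Defs begin

text \<open>
  Both properties say that far apart finite pieces of points of \<open>X\<close> can be put together
  in one point of \<open>X\<close>. This common content is isolated as \<open>gluing\<close>: points
  \<open>y\<^sub>1, \<dots>, y\<^sub>k\<close> of \<open>X\<close>, seen through a finite window \<open>D\<close>, can be pasted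
  at sufficiently distant places, where the required distance depends on \<open>k\<close> and \<open>D\<close> only.
  Gluing for all windows is \<open>k\<close>-mixing (\<open>topologically_mixing_iff_gluing\<close>): cylinders
  are a basis of the topology, and since \<open>A\<close> is finite, a window has only finitely many
  cylinders, so one distance serves all of them.

  If \<open>X\<close> is uniformly SFT on sets of size \<open>k \<cdot> |D|\<close>, then paste the pieces on
  \<open>C = \<Union>\<^sub>i g\<^sub>i D\<close>. A forbidden pattern has bounded extent, so when the
  \<open>g\<^sub>i\<close> are far apart any occurrence of it lies in a single \<open>g\<^sub>i D\<close>, where it would
  already occur in a translate of \<open>y\<^sub>i\<close>, restricted to the same \<open>C\<close>; this is impossible.

  Conversely let \<open>C\<close> have \<open>n\<close> points. Call a set \<open>T\<close> of centres and a finite \<open>K\<close> with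
  \<open>C \<subseteq> T K\<close> good if the centres are farther apart than gluing with window \<open>K\<close>
  requires. Starting with \<open>T = C\<close> and \<open>K = {\<one>}\<close>, drop a centre
  that is too close to another one and enlarge \<open>K\<close> to compensate. This ends after
  at most \<open>n\<close> steps, in a good pair, and \<open>K\<close> stays inside a finite set \<open>L\<close> that depends on
  \<open>n\<close> only (\<open>separated_centres\<close>). Forbidding all patterns with domain inside
  \<open>L\<close> that do not occur in \<open>X\<close> makes the part of a configuration around each centre
  extend to a point of \<open>X\<close>, and gluing combines these points.

  The word metric enters only through its left invariance, \<open>d(g, g) = 0\<close> and the
  finiteness of its balls.
\<close>

section \<open>Finiteness of balls in the word metric\<close>

lemma (in group) foldr_mult_append:
  assumes "set us \<subseteq> carrier G" "set vs \<subseteq> carrier G"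
  shows "foldr (\<otimes>) (us @ vs) \<one> = foldr (\<otimes>) us \<one> \<otimes> foldr (\<otimes>) vs \<one>"
proof -
  have closed: "foldr (\<otimes>) ws \<one> \<in> carrier G" if "set ws \<subseteq> carrier G" for ws
    using that by (induction ws) auto
  show ?thesis
    using assms(1) by (induction us) (auto simp: closed assms(2) m_assoc)
qed

lemma (in group) generate_imp_word:
  assumes "S \<subseteq> carrier G" and "g \<in> generate G S"
  shows "\<exists>ws. set ws \<subseteq> S \<union> m_inv G ` S \<and> foldr (\<otimes>) ws \<one> = g"
  using assms(2)
proof induction
  case one
  show ?case by (rule exI[of _ "[]"]) simp
next
  case (incl h)
  then show ?case using assms(1) by (intro exI[of _ "[h]"]) auto
next
  case (inv h)
  then show ?case using assms(1) by (intro exI[of _ "[inv h]"]) auto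
next
  case (eng h1 h2)
  then obtain us vs where w: "set us \<subseteq> S \<union> m_inv G ` S" "foldr (\<otimes>) us \<one> = h1"
      "set vs \<subseteq> S \<union> m_inv G ` S" "foldr (\<otimes>) vs \<one> = h2" by blast
  have "S \<union> m_inv G ` S \<subseteq> carrier G" using assms(1) by auto
  then show ?case
    using w foldr_mult_append[of us vs] by (intro exI[of _ "us @ vs"]) auto
qed

lemma (in group) word_length_one: "word_length G S \<one> = 0"
  unfolding word_length_def by (rule Least_eq_0) simp

lemma (in group) finite_word_ball:
  assumes "finite S" "S \<subseteq> carrier G" "generate G S = carrier G"
  shows "finite {g \<in> carrier G. word_length G S g \<le> N}"
proof (rule finite_subset)
  let ?W = "{ws. set ws \<subseteq> S \<union> m_inv G ` S \<and> length ws \<le> N}"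
  show "finite ((\<lambda>ws. foldr (\<otimes>) ws \<one>) ` ?W)"
    using assms(1) by (intro finite_imageI finite_lists_length_le) auto
  show "{g \<in> carrier G. word_length G S g \<le> N} \<subseteq> (\<lambda>ws. foldr (\<otimes>) ws \<one>) ` ?W"
  proof safe
    fix g assume g: "g \<in> carrier G" "word_length G S g \<le> N"
    have "\<exists>n ws. length ws = n \<and> set ws \<subseteq> S \<union> m_inv G ` S \<and> foldr (\<otimes>) ws \<one> = g"
      using generate_imp_word[OF assms(2)] g(1) assms(3) by blast
    from LeastI_ex[OF this] obtain ws where
      "length ws = word_length G S g" "set ws \<subseteq> S \<union> m_inv G ` S" "foldr (\<otimes>) ws \<one> = g"
      unfolding word_length_def by blast
    then show "g \<in> (\<lambda>ws. foldr (\<otimes>) ws \<one>) ` ?W"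
      using g(2) by (intro image_eqI[of _ _ ws]) auto
  qed
qed

section \<open>Mixing as gluing\<close>

text \<open>The index set \<open>{1..k}\<close> matches the tuples in the definition of mixing, so that the
  two notions can be compared without reindexing.\<close>

definition separated ::
  "('g, 'm) monoid_scheme \<Rightarrow> 'g set \<Rightarrow> nat \<Rightarrow> nat \<Rightarrow> (nat \<Rightarrow> 'g) \<Rightarrow> bool" where
  "separated G S N k g \<longleftrightarrow>
     (\<forall>i\<in>{1..k}. g i \<in> carrier G) \<and>
     (\<forall>i\<in>{1..k}. \<forall>j\<in>{1..k}. i \<noteq> j \<longrightarrow> word_dist G S (g i) (g j) > N)"

lemma separated_mono: "separated G S N k g \<Longrightarrow> M \<le> N \<Longrightarrow> separated G S M k g"
  unfolding separated_def by fastforce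

text \<open>The bound \<open>N\<close> has to serve all \<open>y\<close> at once, whereas in the definition of mixing it
  may depend on the open sets.\<close>

definition gluing ::
  "('g, 'm) monoid_scheme \<Rightarrow> 'g set \<Rightarrow> ('g \<Rightarrow> 'a) set \<Rightarrow> nat \<Rightarrow> 'g set \<Rightarrow> nat \<Rightarrow> bool" where
  "gluing G S X k D N \<longleftrightarrow>
     (\<forall>g y. separated G S N k g \<and> (\<forall>i\<in>{1..k}. y i \<in> X) \<longrightarrow>
        (\<exists>z\<in>X. \<forall>i\<in>{1..k}. \<forall>h\<in>D. z (g i \<otimes>\<^bsub>G\<^esub> h) = y i h))"

lemma gluingD:
  assumes "gluing G S X k D N" "separated G S N k g" "\<forall>i\<in>{1..k}. y i \<in> X"
  shows "\<exists>z\<in>X. \<forall>i\<in>{1..k}. \<forall>h\<in>D. z (g i \<otimes>\<^bsub>G\<^esub> h) = y i h"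
  using assms by (simp add: gluing_def)

lemma gluing_mono:
  assumes "gluing G S X k D M" "M \<le> N"
  shows "gluing G S X k D N"
  unfolding gluing_def
proof (intro allI impI; elim conjE)
  fix g y assume sep: "separated G S N k g" and y: "\<forall>i\<in>{1..k}. y i \<in> X"
  have "separated G S M k g" using sep assms(2) by (rule separated_mono)
  then show "\<exists>z\<in>X. \<forall>i\<in>{1..k}. \<forall>h\<in>D. z (g i \<otimes>\<^bsub>G\<^esub> h) = y i h"
    by (rule gluingD[OF assms(1) _ y])
qed

lemma finite_uniform_bound:
  fixes Q :: "'f \<Rightarrow> nat \<Rightarrow> bool"
  assumes "finite F" "\<And>f. f \<in> F \<Longrightarrow> \<exists>n. Q f n" "\<And>f m n. Q f m \<Longrightarrow> m \<le> n \<Longrightarrow> Q f n"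
  shows "\<exists>n. \<forall>f\<in>F. Q f n"
  using assms(1,2)
proof (induction F)
  case (insert f F)
  then obtain m n where "\<forall>f\<in>F. Q f m" "Q f n" by blast
  then have "\<forall>f'\<in>insert f F. Q f' (max m n)"
    using assms(3)[OF _ max.cobounded1] assms(3)[OF _ max.cobounded2] by simp
  then show ?case by blast
qed auto

lemma subshift_subset: "subshift G A X \<Longrightarrow> X \<subseteq> carrier G \<rightarrow>\<^sub>E A"
  unfolding subshift_def config_topology_def
  using closedin_subset[of "product_topology (\<lambda>_. discrete_topology A) (carrier G)" X] by simp

lemma openin_cylinder:
  assumes "subshift G A X" "finite D" "D \<subseteq> carrier G"
  shows "openin (subtopology (config_topology G A) X) {z \<in> X. \<forall>h\<in>D. z h = p h}"
proof -
  let ?B = "\<Pi>\<^sub>E h\<in>carrier G. if h \<in> D then A \<inter> {p h} else A"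
  have "openin (config_topology G A) ?B"
    unfolding config_topology_def openin_PiE_gen
    using finite_subset[OF _ assms(2)] by (intro disjI2 conjI) auto
  moreover have "{z \<in> X. \<forall>h\<in>D. z h = p h} = X \<inter> ?B"
  proof (intro equalityI subsetI)
    fix z assume z: "z \<in> {z \<in> X. \<forall>h\<in>D. z h = p h}"
    then have zA: "z \<in> carrier G \<rightarrow>\<^sub>E A" using subshift_subset[OF assms(1)] by blast
    have "p h \<in> A" if "h \<in> D" for h
      using PiE_mem[OF zA, of h] z assms(3) that by auto
    then show "z \<in> X \<inter> ?B" using z zA by (auto simp: PiE_iff)
  next
    fix z assume z: "z \<in> X \<inter> ?B"
    have "z h = p h" if "h \<in> D" for h
    proof -
      have "z \<in> ?B" using z by blast
      from PiE_mem[OF this, of h] show ?thesis using that assms(3) by auto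
    qed
    then show "z \<in> {z \<in> X. \<forall>h\<in>D. z h = p h}" using z by auto
  qed
  ultimately show ?thesis by (simp add: openin_subtopology_Int2)
qed

lemma open_contains_cylinder:
  assumes "subshift G A X" "openin (subtopology (config_topology G A) X) U" "x \<in> U"
  shows "x \<in> X \<and>
    (\<exists>D. finite D \<and> D \<subseteq> carrier G \<and> (\<forall>z\<in>X. (\<forall>h\<in>D. z h = x h) \<longrightarrow> z \<in> U))"
proof -
  obtain W where W: "openin (config_topology G A) W" "U = W \<inter> X"
    using assms(2) by (auto simp: openin_subtopology)
  then obtain V where V: "finite {h \<in> carrier G. V h \<noteq> A}"
      "x \<in> Pi\<^sub>E (carrier G) V" "Pi\<^sub>E (carrier G) V \<subseteq> W"
    using assms(3) unfolding config_topology_def openin_product_topology_alt by fastforce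
  have "z \<in> U" if z: "z \<in> X" "\<forall>h\<in>{h \<in> carrier G. V h \<noteq> A}. z h = x h" for z
  proof -
    have zA: "z \<in> carrier G \<rightarrow>\<^sub>E A" using subshift_subset[OF assms(1)] z(1) by blast
    have "z h \<in> V h" if "h \<in> carrier G" for h
      using z(2) zA V(2) that by (cases "V h = A") auto
    then have "z \<in> Pi\<^sub>E (carrier G) V" using zA by (auto simp: PiE_iff)
    then show ?thesis using V(3) W(2) z(1) by blast
  qed
  then show ?thesis
    using V(1) W(2) assms(3) by (intro conjI exI[of _ "{h \<in> carrier G. V h \<noteq> A}"]) auto
qed

lemma (in group) shift_inv_apply:
  assumes "g \<in> carrier G" "h \<in> carrier G"
  shows "shift G (inv g) z h = z (g \<otimes> h)"
  using assms by (simp add: shift_def)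

lemma (in group) shift_mem:
  "subshift G A X \<Longrightarrow> g \<in> carrier G \<Longrightarrow> z \<in> X \<Longrightarrow> shift G g z \<in> X"
  by (simp add: subshift_def)

text \<open>Restrictions to \<open>D\<close> of points of \<open>X\<close> form a finite set because \<open>A\<close> is finite. So there
  are finitely many \<open>k\<close>-tuples of nonempty cylinders over \<open>D\<close>, and the largest of the
  distances that mixing yields for them works for all points \<open>y\<^sub>i\<close>.\<close>

lemma (in group) mixing_imp_gluing:
  assumes X: "subshift G A X" and "finite A"
    and mix: "topologically_mixing G S A X k"
    and D: "finite D" "D \<subseteq> carrier G"
  shows "\<exists>N. gluing G S X k D N"
proof -
  let ?R = "restrictions X D"
  define U where "U p = {z \<in> X. \<forall>h\<in>D. z h = p h}" for p
  define Q where "Q f N \<longleftrightarrow> (\<forall>g. separated G S N k g \<longrightarrow>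
      (\<exists>x\<in>X. \<forall>i\<in>{1..k}. shift G (inv (g i)) x \<in> U (f i)))" for f N
  have "?R \<subseteq> D \<rightarrow>\<^sub>E A"
    using subshift_subset[OF X] D(2) by (fastforce simp: restrictions_def)
  then have "finite ?R" using finite_PiE[OF D(1)] \<open>finite A\<close> by (meson finite_subset)
  then have fin: "finite ({1..k} \<rightarrow>\<^sub>E ?R)" by (intro finite_PiE) auto
  have ex: "\<exists>N. Q f N" if f: "f \<in> {1..k} \<rightarrow>\<^sub>E ?R" for f
  proof -
    have "openin (subtopology (config_topology G A) X) (U (f i)) \<and> U (f i) \<noteq> {}"
      if i: "i \<in> {1..k}" for i
    proof -
      obtain x where "x \<in> X" "f i = restrict x D"
        using PiE_mem[OF f i] by (auto simp: restrictions_def)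
      then have "x \<in> U (f i)" by (simp add: U_def)
      then show ?thesis using openin_cylinder[OF X D] by (auto simp: U_def)
    qed
    then show ?thesis
      unfolding Q_def separated_def
      by (intro mix[unfolded topologically_mixing_def, THEN spec[where x = "\<lambda>i. U (f i)"],
            THEN mp]) blast
  qed
  have mono: "Q f n" if "Q f m" "m \<le> n" for f m n
    using that separated_mono[OF _ that(2), of G S k] unfolding Q_def by blast
  have "\<exists>N. \<forall>f\<in>{1..k} \<rightarrow>\<^sub>E ?R. Q f N"
    using fin ex by (rule finite_uniform_bound) (assumption, rule mono)
  then obtain N where N: "\<And>f. f \<in> {1..k} \<rightarrow>\<^sub>E ?R \<Longrightarrow> Q f N" by blast
  have "gluing G S X k D N"
    unfolding gluing_def
  proof (intro allI impI; elim conjE)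
    fix g y
    assume g: "separated G S N k g" and y: "\<forall>i\<in>{1..k}. y i \<in> X"
    have "Q (\<lambda>i\<in>{1..k}. restrict (y i) D) N" using y by (intro N) (auto simp: restrictions_def)
    then obtain z where z: "z \<in> X" "\<forall>i\<in>{1..k}. shift G (inv (g i)) z \<in> U (restrict (y i) D)"
      using g unfolding Q_def by fastforce
    have "z (g i \<otimes> h) = y i h" if "i \<in> {1..k}" "h \<in> D" for i h
    proof -
      have "shift G (inv (g i)) z h = y i h" using z that by (simp add: U_def)
      then show ?thesis using shift_inv_apply[of "g i" h z] g that D(2)
        unfolding separated_def by auto
    qed
    then show "\<exists>z\<in>X. \<forall>i\<in>{1..k}. \<forall>h\<in>D. z (g i \<otimes> h) = y i h" using z(1) by blast
  qed
  then show ?thesis by blast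
qed

text \<open>Each \<open>U\<^sub>i\<close> contains a cylinder around one of its points; the union of the \<open>k\<close> cylinder
  domains is a window in which gluing these points suffices.\<close>

lemma (in group) gluing_imp_mixing:
  assumes X: "subshift G A X"
    and glue: "\<And>D. finite D \<Longrightarrow> D \<subseteq> carrier G \<Longrightarrow> \<exists>N. gluing G S X k D N"
  shows "topologically_mixing G S A X k"
  unfolding topologically_mixing_def
proof (intro allI impI)
  fix U assume U: "\<forall>i\<in>{1..k}. openin (subtopology (config_topology G A) X) (U i) \<and> U i \<noteq> {}"
  have "\<forall>i\<in>{1..k}. \<exists>x D. x \<in> X \<and> finite D \<and> D \<subseteq> carrier G \<and>
           (\<forall>z\<in>X. (\<forall>h\<in>D. z h = x h) \<longrightarrow> z \<in> U i)"
  proof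
    fix i assume i: "i \<in> {1..k}"
    then obtain x where x: "x \<in> U i" using U by blast
    then show "\<exists>x D. x \<in> X \<and> finite D \<and> D \<subseteq> carrier G \<and>
           (\<forall>z\<in>X. (\<forall>h\<in>D. z h = x h) \<longrightarrow> z \<in> U i)"
      using open_contains_cylinder[OF X, of "U i" x] U i by auto
  qed
  then obtain x D where xD: "\<And>i. i \<in> {1..k} \<Longrightarrow> x i \<in> X \<and> finite (D i) \<and> D i \<subseteq> carrier G \<and>
           (\<forall>z\<in>X. (\<forall>h\<in>D i. z h = x i h) \<longrightarrow> z \<in> U i)" by metis
  obtain N where N: "gluing G S X k (\<Union>i\<in>{1..k}. D i) N"
    using glue[of "\<Union>i\<in>{1..k}. D i"] xD by blast
  have "\<exists>z\<in>X. \<forall>i\<in>{1..k}. shift G (inv (g i)) z \<in> U i" if g: "separated G S N k g" for g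
  proof -
    obtain z where z: "z \<in> X" "\<forall>i\<in>{1..k}. \<forall>h\<in>(\<Union>i\<in>{1..k}. D i). z (g i \<otimes> h) = x i h"
      using N xD g unfolding gluing_def by blast
    have "shift G (inv (g i)) z \<in> U i" if i: "i \<in> {1..k}" for i
    proof -
      have gi: "g i \<in> carrier G" using g i by (simp add: separated_def)
      have "shift G (inv (g i)) z h = x i h" if "h \<in> D i" for h
        using shift_inv_apply[OF gi, of h z] z(2) xD[OF i] i that by auto
      then show ?thesis using xD[OF i] shift_mem[OF X _ z(1), of "inv (g i)"] gi by auto
    qed
    then show ?thesis using z(1) by blast
  qed
  then show "\<exists>n. \<forall>g. (\<forall>i\<in>{1..k}. g i \<in> carrier G) \<and>
                 (\<forall>i\<in>{1..k}. \<forall>j\<in>{1..k}. i \<noteq> j \<longrightarrow> word_dist G S (g i) (g j) > n) \<longrightarrow>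
           (\<exists>x\<in>X. \<forall>i\<in>{1..k}. shift G (inv (g i)) x \<in> U i)"
    unfolding separated_def by blast
qed

lemma (in group) topologically_mixing_iff_gluing:
  assumes "subshift G A X" "finite A"
  shows "topologically_mixing G S A X k \<longleftrightarrow>
    (\<forall>D. finite D \<and> D \<subseteq> carrier G \<longrightarrow> (\<exists>N. gluing G S X k D N))"
proof (intro iffI allI impI)
  show "\<exists>N. gluing G S X k D N"
    if "topologically_mixing G S A X k" "finite D \<and> D \<subseteq> carrier G" for D
    using mixing_imp_gluing[OF assms] that by simp
  show "topologically_mixing G S A X k"
    if "\<forall>D. finite D \<and> D \<subseteq> carrier G \<longrightarrow> (\<exists>N. gluing G S X k D N)"
    using that by (intro gluing_imp_mixing[OF assms(1)]) simp
qed

section \<open>From forbidden patterns to gluing\<close>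

text \<open>The pasted configuration \<open>x\<close> on \<open>C = \<Union>\<^sub>i g\<^sub>i D\<close> contains no forbidden pattern, as an
  occurrence would be confined to a single \<open>g\<^sub>i D\<close>, where \<open>x\<close> agrees with the
  point \<open>g\<^sub>i y\<^sub>i\<close> of \<open>X\<close>. Comparing \<open>x\<close> with the restriction of that point to the same
  set \<open>C\<close>, instead of to \<open>g\<^sub>i D\<close>, keeps the cardinality at \<open>k \<cdot> |D|\<close>, the only one for which
  the list of forbidden patterns is known to be correct.\<close>

lemma (in group) SFT_imp_gluing:
  assumes X: "subshift G A X" and k: "k \<ge> 1"
    and D: "finite D" "D \<subseteq> carrier G"
    and sft: "uniformly_SFT_on G A X (subsets_of_card G (k * card D))"
  shows "\<exists>N. gluing G S X k D N"
proof -
  obtain \<P> where P: "finite \<P>" "\<P> \<subseteq> patterns G A"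
    and sft': "\<forall>C\<in>subsets_of_card G (k * card D). \<forall>x\<in>C \<rightarrow>\<^sub>E A.
        x \<in> restrictions X C \<longleftrightarrow> \<not> (\<exists>p\<in>\<P>. occurs_in G p C x)"
    using sft unfolding uniformly_SFT_on_def by (elim exE conjE)
  note iff = bspec[OF bspec[OF sft']]
  \<comment> \<open>The unit is included so that the fact \<open>same\<close> below, applied to \<open>e = e' = \<one>\<close>, also shows
    that the sets \<open>g\<^sub>i D\<close> are disjoint.\<close>
  define E where "E = insert \<one> (\<Union>p\<in>\<P>. fst p)"
  have E: "finite E" "E \<subseteq> carrier G" using P by (force simp: E_def patterns_def)+
  \<comment> \<open>If one translate of \<open>E\<close> meets both \<open>g\<^sub>i D\<close> and \<open>g\<^sub>j D\<close>, then \<open>g\<^sub>i\<close> and \<open>g\<^sub>j\<close> differ by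
    an element of the finite set \<open>F\<close>, so their distance is at most \<open>N\<close>.\<close>
  define F where "F = (\<lambda>(h, e, e', h'). h \<otimes> inv e \<otimes> (e' \<otimes> inv h')) ` (D \<times> E \<times> E \<times> D)"
  define N where "N = Max (insert 0 (word_length G S ` F))"
  have NF: "word_length G S f \<le> N" if "f \<in> F" for f
    unfolding N_def using D(1) E(1) that by (intro Max_ge) (auto simp: F_def)
  have "gluing G S X k D N"
    unfolding gluing_def
  proof (intro allI impI; elim conjE)
    fix g y
    assume sep: "separated G S N k g" and y: "\<forall>i\<in>{1..k}. y i \<in> X"
    have g: "g i \<in> carrier G" if "i \<in> {1..k}" for i using sep that by (simp add: separated_def)
    have same: "i = j" if ij: "i \<in> {1..k}" "j \<in> {1..k}" and h: "h \<in> D" "h' \<in> D"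
      and e: "e \<in> E" "e' \<in> E" and u: "u \<in> carrier G"
      and eq: "u \<otimes> e = g i \<otimes> h" "u \<otimes> e' = g j \<otimes> h'" for i j h h' e e' u
    proof (rule ccontr)
      assume "i \<noteq> j"
      note c = g[OF ij(1)] g[OF ij(2)] subsetD[OF D(2) h(1)] subsetD[OF D(2) h(2)]
        subsetD[OF E(2) e(1)] subsetD[OF E(2) e(2)]
      have gi: "g i = u \<otimes> e \<otimes> inv h" and gj: "g j = u \<otimes> e' \<otimes> inv h'"
        using eq c u by (simp_all add: m_assoc)
      have "inv (g i) \<otimes> g j = h \<otimes> inv e \<otimes> (e' \<otimes> inv h')"
        unfolding gi gj using c u
        by (simp add: inv_mult_group m_assoc inv_solve_left')
      then have "inv (g i) \<otimes> g j \<in> F" using h e unfolding F_def by force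
      from NF[OF this] have "word_dist G S (g i) (g j) \<le> N" by (simp add: word_dist_def)
      moreover have "word_dist G S (g i) (g j) > N"
        using sep ij \<open>i \<noteq> j\<close> unfolding separated_def by blast
      ultimately show False by simp
    qed
    define C where "C = (\<Union>i\<in>{1..k}. g i <# D)"
    have C: "C = (\<lambda>(i, h). g i \<otimes> h) ` ({1..k} \<times> D)" by (auto simp: C_def l_coset_def)
    have inj: "inj_on (\<lambda>(i, h). g i \<otimes> h) ({1..k} \<times> D)"
    proof (rule inj_onI; clarify)
      fix i h j h' assume a: "i \<in> {1..k}" "j \<in> {1..k}" "h \<in> D" "h' \<in> D" "g i \<otimes> h = g j \<otimes> h'"
      then have "i = j"
        using same[of i j h h' \<one> \<one> "g i \<otimes> h"] g D(2) by (auto simp: E_def)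
      moreover have "h = h'"
        using a(5) g[OF a(2)] subsetD[OF D(2) a(3)] subsetD[OF D(2) a(4)] unfolding \<open>i = j\<close>
        by simp
      ultimately show "i = j \<and> h = h'" by blast
    qed
    have Cn: "C \<in> subsets_of_card G (k * card D)"
      using g D card_image[OF inj] by (auto simp: subsets_of_card_def C card_cartesian_product)
    define s where "s = inv_into ({1..k} \<times> D) (\<lambda>(i, h). g i \<otimes> h)"
    define x where "x = (\<lambda>c\<in>C. case s c of (i, h) \<Rightarrow> y i h)"
    have x: "x (g i \<otimes> h) = y i h" if "i \<in> {1..k}" "h \<in> D" for i h
    proof -
      have "s (g i \<otimes> h) = (i, h)" using inv_into_f_f[OF inj, of "(i, h)"] that by (simp add: s_def)
      moreover have "g i \<otimes> h \<in> C" using that by (force simp: C)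
      ultimately show ?thesis by (simp add: x_def)
    qed
    have yA: "y i h \<in> A" if "i \<in> {1..k}" "h \<in> carrier G" for i h
      using y that subshift_subset[OF X] by (meson PiE_mem subsetD)
    have xA: "x \<in> C \<rightarrow>\<^sub>E A"
    proof (rule PiE_I)
      show "x c \<in> A" if "c \<in> C" for c using that D(2) by (auto simp: C x yA)
    qed (simp add: x_def)
    have "\<not> occurs_in G p C x" if p: "p \<in> \<P>" for p
    proof
      assume occ: "occurs_in G p C x"
      obtain H P where HP: "p = (H, P)" by (cases p)
      have HE: "H \<subseteq> E" using p HP by (auto simp: E_def)
      obtain u where u: "u \<in> carrier G" "u <# H \<subseteq> C" "\<forall>e\<in>H. x (u \<otimes> e) = P e"
        using occ by (auto simp: occurs_in_def HP)
      have ex: "\<exists>i\<in>{1..k}. \<exists>h\<in>D. u \<otimes> e = g i \<otimes> h" if "e \<in> H" for e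
        using u(2) that by (fastforce simp: C l_coset_def)
      \<comment> \<open>The occurrence lies in one piece. The empty pattern lies in any piece, and there is one
        since \<open>k \<ge> 1\<close>.\<close>
      have "\<exists>i\<in>{1..k}. \<forall>e\<in>H. \<exists>h\<in>D. u \<otimes> e = g i \<otimes> h"
      proof (cases "H = {}")
        case True
        then show ?thesis using k by (intro bexI[of _ 1]) auto
      next
        case False
        then obtain e i h where 0: "e \<in> H" "i \<in> {1..k}" "h \<in> D" "u \<otimes> e = g i \<otimes> h" using ex by blast
        have "\<exists>h\<in>D. u \<otimes> e' = g i \<otimes> h" if "e' \<in> H" for e'
          using ex[OF that] same[OF 0(2) _ 0(3) _ _ _ u(1) 0(4)] HE 0(1) that by blast
        then show ?thesis using 0(2) by blast
      qed
      then obtain i where i: "i \<in> {1..k}" "\<forall>e\<in>H. \<exists>h\<in>D. u \<otimes> e = g i \<otimes> h" by blast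
      let ?z = "shift G (g i) (y i)"
      have zX: "?z \<in> X" using shift_mem[OF X g[OF i(1)]] y i(1) by blast
      have "restrict ?z C (u \<otimes> e) = P e" if e: "e \<in> H" for e
      proof -
        obtain h where h: "h \<in> D" "u \<otimes> e = g i \<otimes> h" using i(2) e by blast
        have "u \<otimes> e \<in> C" using u(2) e by (auto simp: l_coset_def)
        moreover have "?z (g i \<otimes> h) = y i h"
          using g[OF i(1)] h(1) D(2) by (auto simp: shift_def m_assoc[symmetric])
        ultimately show ?thesis using u(3) e x[OF i(1) h(1)] h(2) by auto
      qed
      then have "occurs_in G p C (restrict ?z C)"
        unfolding occurs_in_def HP prod.case using u(1,2) by blast
      moreover have "restrict ?z C \<in> restrictions X C" using zX by (auto simp: restrictions_def)
      moreover have "restrict ?z C \<in> C \<rightarrow>\<^sub>E A"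
      proof (rule PiE_I)
        show "restrict ?z C c \<in> A" if "c \<in> C" for c
          using PiE_mem[OF subsetD[OF subshift_subset[OF X] zX], of c] Cn that
          by (auto simp: subsets_of_card_def)
      qed simp
      ultimately show False using iff[OF Cn] p by blast
    qed
    then have "x \<in> restrictions X C" using iff[OF Cn xA] by blast
    then obtain z where z: "z \<in> X" "x = restrict z C" by (auto simp: restrictions_def)
    have "z (g i \<otimes> h) = y i h" if "i \<in> {1..k}" "h \<in> D" for i h
    proof -
      have "g i \<otimes> h \<in> C" using that by (force simp: C)
      then show ?thesis using x[OF that] z(2) by simp
    qed
    then show "\<exists>z\<in>X. \<forall>i\<in>{1..k}. \<forall>h\<in>D. z (g i \<otimes> h) = y i h" using z(1) by blast
  qed
  then show ?thesis by blast
qed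

section \<open>From gluing to forbidden patterns\<close>

text \<open>A place \<open>g\<close> where \<open>P\<close> occurs in a point of \<open>X\<close> can be moved to \<open>\<one>\<close>, by invariance of \<open>X\<close>.
  Hence a pattern that is not a restriction of a point of \<open>X\<close> may safely be forbidden,
  and a list of such patterns never excludes a restriction of a point of \<open>X\<close>.\<close>

lemma (in group) occurs_in_restrict_shift:
  assumes X: "subshift G A X" and z: "z \<in> X" and D: "D \<subseteq> carrier G" "P \<in> D \<rightarrow>\<^sub>E B"
    and occ: "occurs_in G (D, P) C (restrict z C)"
  shows "P \<in> restrictions X D"
proof -
  obtain g where g: "g \<in> carrier G" "g <# D \<subseteq> C" "\<forall>h\<in>D. restrict z C (g \<otimes> h) = P h"
    using occ by (auto simp: occurs_in_def)
  have "P h = shift G (inv g) z h" if "h \<in> D" for h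
  proof -
    have "g \<otimes> h \<in> C" using g(2) that by (auto simp: l_coset_def)
    then show ?thesis
      using bspec[OF g(3) that] shift_inv_apply[OF g(1) subsetD[OF D(1) that], of z] by simp
  qed
  then have "P = restrict (shift G (inv g) z) D"
    using D(2) by (intro ext) (auto simp: PiE_iff extensional_def)
  then show ?thesis
    using shift_mem[OF X _ z, of "inv g"] g(1) by (auto simp: restrictions_def)
qed

text \<open>Induction on the number of centres: if \<open>s \<noteq> t\<close> are centres at distance at most \<open>N K\<close>
  and \<open>B\<close> is the ball of radius \<open>N K\<close>, then \<open>t \<in> s B\<close>, so \<open>t K \<subseteq> s B K\<close> and \<open>t\<close> can be
  dropped once \<open>K\<close> is replaced by \<open>B K\<close>. The required distance \<open>N\<close> may depend on \<open>K\<close>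
  because \<open>K\<close> takes at most \<open>m\<close> values before the centres run out, and these values do not
  depend on \<open>T\<close>; \<open>L\<close> is their union.\<close>

lemma (in group) separated_centres:
  fixes N :: "'a set \<Rightarrow> nat"
  assumes S: "finite S" "S \<subseteq> carrier G" "generate G S = carrier G"
    and "finite K" "K \<subseteq> carrier G"
  shows "\<exists>L. finite L \<and> L \<subseteq> carrier G \<and>
    (\<forall>T. T \<subseteq> carrier G \<and> finite T \<and> card T \<le> m \<longrightarrow>
      (\<exists>T'\<subseteq>T. \<exists>K'\<subseteq>L. T <#> K \<subseteq> T' <#> K' \<and>
         (\<forall>s\<in>T'. \<forall>t\<in>T'. s \<noteq> t \<longrightarrow> word_dist G S s t > N K')))"
  using assms(4,5)
proof (induction m arbitrary: K)
  case 0
  show ?case by (rule exI[of _ "{}"]) (auto simp: set_mult_def)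
next
  case (Suc m)
  define B where "B = {g \<in> carrier G. word_length G S g \<le> N K}"
  have B: "finite B" "B \<subseteq> carrier G" "\<one> \<in> B"
    using finite_word_ball[OF S] by (auto simp: B_def word_length_one)
  have BK: "finite (B <#> K)" "B <#> K \<subseteq> carrier G"
    using B Suc.prems by (auto simp: set_mult_def)
  obtain L where L: "finite L" "L \<subseteq> carrier G"
    "\<forall>T. T \<subseteq> carrier G \<and> finite T \<and> card T \<le> m \<longrightarrow>
      (\<exists>T'\<subseteq>T. \<exists>K'\<subseteq>L. T <#> (B <#> K) \<subseteq> T' <#> K' \<and>
         (\<forall>s\<in>T'. \<forall>t\<in>T'. s \<noteq> t \<longrightarrow> word_dist G S s t > N K'))"
    using Suc.IH[OF BK] by (elim exE conjE)
  have centres: "\<exists>T'\<subseteq>T. \<exists>K'\<subseteq>L \<union> K. T <#> K \<subseteq> T' <#> K' \<and>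
         (\<forall>s\<in>T'. \<forall>t\<in>T'. s \<noteq> t \<longrightarrow> word_dist G S s t > N K')"
    if T: "T \<subseteq> carrier G" "finite T" "card T \<le> Suc m" for T
  proof (cases "\<forall>s\<in>T. \<forall>t\<in>T. s \<noteq> t \<longrightarrow> word_dist G S s t > N K")
    case True
    then show ?thesis by - (rule exI[of _ T], intro conjI exI[of _ K], auto)
  next
    case False
    then obtain s t where st: "s \<in> T" "t \<in> T" "s \<noteq> t" "word_dist G S s t \<le> N K"
      by (auto simp: not_less)
    have sub: "T <#> K \<subseteq> (T - {t}) <#> (B <#> K)"
    proof
      fix c assume "c \<in> T <#> K"
      then obtain r a where ra: "r \<in> T" "a \<in> K" "c = r \<otimes> a" by (auto simp: set_mult_def)
      show "c \<in> (T - {t}) <#> (B <#> K)"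
      proof (cases "r = t")
        case True
        have "c = s \<otimes> (inv s \<otimes> t \<otimes> a)"
          using ra True st T(1) Suc.prems(2) by (simp add: m_assoc[symmetric] subset_iff)
        moreover have "inv s \<otimes> t \<in> B"
          using st T(1) by (auto simp: B_def word_dist_def)
        ultimately show ?thesis using st ra unfolding set_mult_def by blast
      next
        case False
        have "c = r \<otimes> (\<one> \<otimes> a)" using ra Suc.prems(2) by auto
        then show ?thesis using False ra B(3) unfolding set_mult_def by blast
      qed
    qed
    have "T - {t} \<subseteq> carrier G \<and> finite (T - {t}) \<and> card (T - {t}) \<le> m"
      using T st(2) by auto
    from L(3)[rule_format, OF this] obtain T' K' where "T' \<subseteq> T - {t}" "K' \<subseteq> L"
      "(T - {t}) <#> (B <#> K) \<subseteq> T' <#> K'"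
      "\<forall>s\<in>T'. \<forall>t\<in>T'. s \<noteq> t \<longrightarrow> word_dist G S s t > N K'" by blast
    then show ?thesis using sub by - (rule exI[of _ T'], intro conjI exI[of _ K'], auto)
  qed
  show ?case
    using L(1,2) Suc.prems by (intro centres exI[of _ "L \<union> K"] conjI allI impI) auto
qed

text \<open>Given \<open>C\<close>, take separated centres \<open>T\<close> with \<open>C \<subseteq> T K\<close>. For \<open>t \<in> T\<close> the part of the
  configuration on \<open>C \<inter> t K\<close>, moved by \<open>t\<inverse>\<close>, is a pattern with domain inside \<open>L\<close>, so it is
  allowed and extends to a point of \<open>X\<close>. Gluing these points with window \<open>K\<close> reproduces the configuration on
  all of \<open>C\<close>.\<close>

lemma (in group) gluing_imp_SFT:
  assumes S: "finite S" "S \<subseteq> carrier G" "generate G S = carrier G"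
    and X: "subshift G A X" and A: "finite A"
    and glue: "\<And>k D. k \<ge> 1 \<Longrightarrow> finite D \<Longrightarrow> D \<subseteq> carrier G \<Longrightarrow> \<exists>N. gluing G S X k D N"
  shows "uniformly_SFT_on G A X (subsets_of_card G n)"
proof -
  have "\<exists>M. \<forall>k\<in>{1..n}. gluing G S X k K M" if "finite K" "K \<subseteq> carrier G" for K
  proof (rule finite_uniform_bound)
    show "\<exists>M. gluing G S X k K M" if "k \<in> {1..n}" for k
      using glue[OF _ \<open>finite K\<close> \<open>K \<subseteq> carrier G\<close>] that by simp
  qed (simp, rule gluing_mono)
  then have "\<forall>K. \<exists>M. finite K \<and> K \<subseteq> carrier G \<longrightarrow> (\<forall>k\<in>{1..n}. gluing G S X k K M)"
    by blast
  from choice[OF this] obtain N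
    where "\<forall>K. finite K \<and> K \<subseteq> carrier G \<longrightarrow> (\<forall>k\<in>{1..n}. gluing G S X k K (N K))"
    by (elim exE)
  then have N: "gluing G S X k K (N K)" if "finite K" "K \<subseteq> carrier G" "k \<in> {1..n}" for k K
    using that by simp
  have one: "finite {\<one>}" "{\<one>} \<subseteq> carrier G" by auto
  obtain L where L: "finite L" "L \<subseteq> carrier G"
    "\<forall>T. T \<subseteq> carrier G \<and> finite T \<and> card T \<le> n \<longrightarrow>
      (\<exists>T'\<subseteq>T. \<exists>K'\<subseteq>L. T <#> {\<one>} \<subseteq> T' <#> K' \<and>
         (\<forall>s\<in>T'. \<forall>t\<in>T'. s \<noteq> t \<longrightarrow> word_dist G S s t > N K'))"
    using separated_centres[OF S one, of n N] by (elim exE conjE)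
  \<comment> \<open>If \<open>X\<close> is empty, the empty pattern is among those forbidden and excludes everything.\<close>
  define \<P> where "\<P> = {(D, P). D \<subseteq> L \<and> P \<in> D \<rightarrow>\<^sub>E A \<and> P \<notin> restrictions X D}"
  have "\<P> \<subseteq> (SIGMA D:Pow L. D \<rightarrow>\<^sub>E A)" by (auto simp: \<P>_def)
  moreover have "finite (SIGMA D:Pow L. D \<rightarrow>\<^sub>E A)"
    using L(1) A by (intro finite_SigmaI finite_PiE) (auto intro: finite_subset)
  ultimately have "finite \<P>" by (rule finite_subset)
  moreover have "\<P> \<subseteq> patterns G A"
    using L(1,2) by (auto simp: \<P>_def patterns_def intro: finite_subset)
  moreover have "x \<in> restrictions X C \<longleftrightarrow> \<not> (\<exists>p\<in>\<P>. occurs_in G p C x)"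
    if Cn: "C \<in> subsets_of_card G n" and x: "x \<in> C \<rightarrow>\<^sub>E A" for C x
  proof
    assume "x \<in> restrictions X C"
    then obtain z where "z \<in> X" "x = restrict z C" by (auto simp: restrictions_def)
    then show "\<not> (\<exists>p\<in>\<P>. occurs_in G p C x)"
      using occurs_in_restrict_shift[OF X] L(2) by (auto simp: \<P>_def)
  next
    assume no: "\<not> (\<exists>p\<in>\<P>. occurs_in G p C x)"
    have local: "\<exists>w\<in>X. \<forall>h\<in>D. w h = x (t \<otimes> h)"
      if t: "t \<in> carrier G" and D: "D \<subseteq> L" and tD: "t <# D \<subseteq> C" for t D
    proof -
      let ?P = "\<lambda>h\<in>D. x (t \<otimes> h)"
      have "occurs_in G (D, ?P) C x" using t tD by (auto simp: occurs_in_def)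
      then have "(D, ?P) \<notin> \<P>" using no by blast
      moreover have "?P \<in> D \<rightarrow>\<^sub>E A" using tD x by (auto simp: l_coset_def)
      ultimately obtain w where "w \<in> X" "?P = restrict w D"
        using D by (auto simp: \<P>_def restrictions_def)
      then show ?thesis by (metis restrict_apply')
    qed
    have C: "C \<subseteq> carrier G" "finite C" "card C = n" using Cn by (auto simp: subsets_of_card_def)
    obtain T K where T: "T \<subseteq> C" and K: "K \<subseteq> L" and cover: "C <#> {\<one>} \<subseteq> T <#> K"
      and sep: "\<forall>s\<in>T. \<forall>t\<in>T. s \<noteq> t \<longrightarrow> word_dist G S s t > N K"
      using L(3)[rule_format, of C] C by auto
    have finT: "finite T" "card T \<le> n" using T C card_mono finite_subset by auto
    have cover': "\<exists>t\<in>T. \<exists>h\<in>K. c = t \<otimes> h" if "c \<in> C" for c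
    proof -
      have "c \<in> C <#> {\<one>}" using that C(1) by (force simp: set_mult_def)
      then show ?thesis using cover by (fastforce simp: set_mult_def)
    qed
    have "\<exists>z\<in>X. \<forall>t\<in>T. \<forall>h\<in>K. t \<otimes> h \<in> C \<longrightarrow> z (t \<otimes> h) = x (t \<otimes> h)"
    proof (cases "T = {}")
      case True
      \<comment> \<open>Here \<open>C\<close> is empty; \<open>X\<close> is not, as the empty pattern does not occur.\<close>
      then show ?thesis using local[of \<one> "{}"] by (auto simp: l_coset_def)
    next
      case False
      obtain g where g: "bij_betw g {1..card T} T"
        using ex_bij_betw_nat_finite_1[OF finT(1)] by blast
      have gT: "g i \<in> T" if "i \<in> {1..card T}" for i using g that by (auto dest: bij_betwE)
      have k: "card T \<in> {1..n}" using False finT by (simp add: card_gt_0_iff Suc_le_eq)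
      have far: "separated G S (N K) (card T) g"
        unfolding separated_def
      proof (intro conjI ballI impI)
        show "g i \<in> carrier G" if "i \<in> {1..card T}" for i using gT[OF that] T C(1) by blast
        show "word_dist G S (g i) (g j) > N K"
          if "i \<in> {1..card T}" "j \<in> {1..card T}" "i \<noteq> j" for i j
          using sep gT that bij_betw_imp_inj_on[OF g] by (meson inj_onD)
      qed
      have "\<forall>t\<in>T. \<exists>w. w \<in> X \<and> (\<forall>h\<in>K. t \<otimes> h \<in> C \<longrightarrow> w h = x (t \<otimes> h))"
      proof
        fix t assume "t \<in> T"
        then have "\<exists>w\<in>X. \<forall>h\<in>{h \<in> K. t \<otimes> h \<in> C}. w h = x (t \<otimes> h)"
          using T C(1) K by (intro local) (auto simp: l_coset_def)
        then show "\<exists>w. w \<in> X \<and> (\<forall>h\<in>K. t \<otimes> h \<in> C \<longrightarrow> w h = x (t \<otimes> h))" by blast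
      qed
      from bchoice[OF this] obtain w where
        w: "\<forall>t\<in>T. w t \<in> X \<and> (\<forall>h\<in>K. t \<otimes> h \<in> C \<longrightarrow> w t h = x (t \<otimes> h))" by (elim exE)
      have wX: "\<forall>i\<in>{1..card T}. w (g i) \<in> X" using w gT by blast
      have gl: "gluing G S X (card T) K (N K)"
        using K L(1,2) by (intro N k) (auto intro: finite_subset)
      obtain z where z: "z \<in> X"
        "\<forall>i\<in>{1..card T}. \<forall>h\<in>K. z (g i \<otimes> h) = w (g i) h"
        using gluingD[OF gl far wX] by blast
      have "z (t \<otimes> h) = x (t \<otimes> h)" if "t \<in> T" "h \<in> K" "t \<otimes> h \<in> C" for t h
      proof -
        have "t \<in> g ` {1..card T}" using that(1) bij_betw_imp_surj_on[OF g] by simp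
        then obtain i where "t = g i" "i \<in> {1..card T}" by (elim imageE)
        then show ?thesis using bspec[OF bspec[OF z(2)] that(2)] w that by simp
      qed
      then show ?thesis using z(1) by blast
    qed
    then obtain z where z: "z \<in> X" "\<forall>t\<in>T. \<forall>h\<in>K. t \<otimes> h \<in> C \<longrightarrow> z (t \<otimes> h) = x (t \<otimes> h)" by blast
    have "z c = x c" if "c \<in> C" for c using cover'[OF that] z(2) that by blast
    then have "x = restrict z C" using x by (intro ext) (auto simp: PiE_iff extensional_def)
    then show "x \<in> restrictions X C" using z(1) by (auto simp: restrictions_def)
  qed
  ultimately show ?thesis
    unfolding uniformly_SFT_on_def by (intro exI[of _ \<P>] conjI ballI)
qed

theorem proposition5p3:
  fixes G :: "('g, 'm) monoid_scheme" and S :: "'g set"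
    and A :: "'a set" and X :: "('g \<Rightarrow> 'a) set"
  assumes "group G"
    and "finite S" and "S \<subseteq> carrier G" and "generate G S = carrier G"
    and "finite A"
    and "subshift G A X"
  shows "(\<forall>n. uniformly_SFT_on G A X (subsets_of_card G n)) \<longleftrightarrow>
         (\<forall>k\<ge>1. topologically_mixing G S A X k)"
proof -
  interpret group G by fact
  have mix: "topologically_mixing G S A X k \<longleftrightarrow>
      (\<forall>D. finite D \<and> D \<subseteq> carrier G \<longrightarrow> (\<exists>N. gluing G S X k D N))" for k
    using assms(6,5) by (rule topologically_mixing_iff_gluing)
  show ?thesis
  proof
    assume "\<forall>n. uniformly_SFT_on G A X (subsets_of_card G n)"
    then show "\<forall>k\<ge>1. topologically_mixing G S A X k"
      unfolding mix using SFT_imp_gluing[OF assms(6)] by blast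
  next
    assume "\<forall>k\<ge>1. topologically_mixing G S A X k"
    then have "\<exists>N. gluing G S X k D N" if "k \<ge> 1" "finite D" "D \<subseteq> carrier G" for k D
      using that unfolding mix by blast
    then show "\<forall>n. uniformly_SFT_on G A X (subsets_of_card G n)"
      by (intro allI gluing_imp_SFT[OF assms(2,3,4,6,5)])
  qed
qed

end
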